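(* Let $a_1,\ldots,a_n$ be nonnegative integers and let $r,s,t$ be distinct integers with $1\leq r,s,t\leq n$. Then $$\mathrm{CT}_{\mathbf{x}}\ \frac{x_sx_t}{x_r^2}D_n(\mathbf{x},\mathbf{a})=\frac{a_r}{(1+a^{(r)})(2+a^{(r)})}\bigg[(a+a_r)-\sum_{\substack{1\le i\le n\\ i\neq r,s,t}}\frac{a_i(1+a)}{1+a^{(r)}-a_i}\bigg]C_n(\mathbf{a}).$$
   Context: For nonnegative integers $a_1,\ldots,a_n$, write $\mathbf{a}=(a_1,\ldots,a_n)$ and $\mathbf{x}=(x_1,\ldots,x_n)$ (indeterminates). The Dyson product is the Laurent polynomial $D_n(\mathbf{x},\mathbf{a}):=\prod_{1\le i\ne j\le n}\left(1-\frac{x_i}{x_j}\right)^{a_i}$ (product over all ordered pairs $(i,j)$ with $i\neq j$). $\mathrm{CT}_{\mathbf{x}}f(\mathbf{x})$ denotes the constant term of the Laurent polynomial $f$ in the variables $x_1,\ldots,x_n$, i.e. the coefficient of $x_1^0\cdots x_n^0$. Set $a:=a_1+a_2+\cdots+a_n$, $a^{(j)}:=a-a_j$, and $C_n(\mathbf{a}):=\frac{(a_1+a_2+\cdots+a_n)!}{a_1!\,a_2!\cdots a_n!}$. *)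

theory Defs
  imports Complex_Main "HOL-Library.Poly_Mapping"
begin

text \<open>
  A Laurent polynomial is a finitely supported map from exponent vectors to rational
  coefficients; the exponent vectors are themselves finitely supported maps from
  variable indices to integers. The product that \<^theory>\<open>HOL-Library.Poly_Mapping\<close> puts on
  the outer map is convolution over the exponent group, i.e. the usual multiplication.
  The type offers an indeterminate for every natural number; only
  \<open>x\<^sub>1, \<dots>, x\<^sub>n\<close> occur in the objects below.
\<close>

type_synonym laurent_poly = "(nat \<Rightarrow>\<^sub>0 int) \<Rightarrow>\<^sub>0 rat"

text \<open>\<open>xpow i k\<close> is the monomial \<open>x\<^sub>i\<close> to the integer power \<open>k\<close>.\<close>

definition xpow :: "nat \<Rightarrow> int \<Rightarrow> laurent_poly" where
  "xpow i k = Poly_Mapping.single (Poly_Mapping.single i k) 1"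

definition CT :: "laurent_poly \<Rightarrow> rat" where
  "CT f = Poly_Mapping.lookup f 0"

definition dyson_product :: "nat \<Rightarrow> (nat \<Rightarrow> nat) \<Rightarrow> laurent_poly" where
  "dyson_product n a =
     (\<Prod>(i, j) \<in> {(i, j). i \<in> {1..n} \<and> j \<in> {1..n} \<and> i \<noteq> j}. (1 - xpow i 1 * xpow j (-1)) ^ a i)"

definition weight :: "nat \<Rightarrow> (nat \<Rightarrow> nat) \<Rightarrow> nat" where
  "weight n a = (\<Sum>i\<in>{1..n}. a i)"

text \<open>
  The number \<open>a\<^sup>(\<^sup>j\<^sup>)\<close>. The subtraction on \<^typ>\<open>nat\<close> does not truncate for \<open>j\<close> in
  \<open>{1..n}\<close>, where \<open>a j \<le> weight n a\<close>.
\<close>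

definition weight_except :: "nat \<Rightarrow> (nat \<Rightarrow> nat) \<Rightarrow> nat \<Rightarrow> nat" where
  "weight_except n a j = weight n a - a j"

definition dyson_coeff :: "nat \<Rightarrow> (nat \<Rightarrow> nat) \<Rightarrow> rat" where
  "dyson_coeff n a = fact (weight n a) / (\<Prod>i\<in>{1..n}. fact (a i))"

end

theory Submission
  imports Defs "HOL-Computational_Algebra.Polynomial"
begin

text \<open>
  The proof extends Good's proof of Dyson's conjecture. Write \<open>D a\<close> for the Dyson product,
  \<open>C a\<close> for the multinomial coefficient, and \<open>a - e\<^sub>k\<close> for \<open>a\<close> with its \<open>k\<close>-th entry lowered by 1.
  Lagrange interpolation gives \<open>D a = (\<Sum>k. D (a - e\<^sub>k))\<close> whenever all exponents are positive
  (\<open>dyson_recurrence\<close>). For a fixed Laurent monomial \<open>m\<close>, the constant term of \<open>m * D a\<close> satisfies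
  the same recursion. It is therefore determined by its values where some exponent \<open>a k\<close> is 0.
  There \<open>x\<^sub>k\<close> occurs only in the factors \<open>(1 - x\<^sub>i / x\<^sub>k) ^ a i\<close>, and expanding these in powers of
  \<open>1 / x\<^sub>k\<close> expresses the constant term by constant terms in one variable less
  (\<open>CT_dyson_remove\<close>).

  Deleting a variable from \<open>x\<^sub>s x\<^sub>t / x\<^sub>r\<^sup>2\<close> produces \<open>x\<^sub>i x\<^sub>t / x\<^sub>r\<^sup>2\<close> for all other \<open>i\<close>, and so
  \<open>x\<^sub>t\<^sup>2 / x\<^sub>r\<^sup>2\<close> and \<open>x\<^sub>t / x\<^sub>r\<close> as well; from the former one obtains the same shapes and 1. The four shapes
  1, \<open>x\<^sub>s / x\<^sub>r\<close>, \<open>x\<^sub>s\<^sup>2 / x\<^sub>r\<^sup>2\<close> and \<open>x\<^sub>s x\<^sub>t / x\<^sub>r\<^sup>2\<close> are thus closed under the reduction, and their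
  constant terms can be found together. With \<open>b\<close> the sum of all exponents other than \<open>a r\<close>, they
  are \<open>C a\<close>, then \<open>- a r / (1 + b) * C a\<close>, and for the last two
  \<open>a r / ((1 + b) * (2 + b)) * B * C a\<close> with the factor \<open>B\<close> called \<open>bracket\<close> below.

  It remains to check that these formulas obey both rules. The recursion becomes a mean value
  property of the factor in front of \<open>C a\<close> (\<open>harmonic\<close>), which is linear and needs to be verified
  for three rational functions only. The boundary values become linear relations among the factors
  \<open>B\<close> (\<open>bracket_boundary_distinct\<close>, \<open>bracket_boundary_double\<close>); they follow from the identity
  \<open>a i * (h i + 1) = (1 + b) * h i\<close> for \<open>h i = a i / (1 + b - a i)\<close>.
\<close>

section \<open>Good's recursion\<close>

text \<open>
  This is Lagrange interpolation of the constant 1 with the division cleared. As a polynomial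
  in an auxiliary \<open>T\<close>, the sum over \<open>k\<close> of \<open>\<Prod>i\<noteq>k. P i\<close> times \<open>\<Prod>j\<noteq>k. (1 - T * y j)\<close>
  has degree less than \<open>card I\<close>. At \<open>T = x m\<close> every summand but the one with
  \<open>k = m\<close> contains the factor \<open>1 - x m * y m = 0\<close>, and that one equals the full
  product. So the polynomial is constant, and the identity is its value at \<open>T = 0\<close>.
\<close>

lemma good_identity:
  fixes x y :: "'b \<Rightarrow> 'a::idom"
  assumes fin: "finite I" and ne: "I \<noteq> {}" and inv: "\<And>i. i \<in> I \<Longrightarrow> x i * y i = 1" and inj: "inj_on x I"
  shows "(\<Sum>k\<in>I. \<Prod>i\<in>I-{k}. \<Prod>j\<in>I-{i}. 1 - x i * y j) = (\<Prod>i\<in>I. \<Prod>j\<in>I-{i}. 1 - x i * y j)"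
proof -
  define P where "P i = (\<Prod>j\<in>I-{i}. 1 - x i * y j)" for i
  define f where "f = (\<Sum>k\<in>I. smult (\<Prod>i\<in>I-{k}. P i) (\<Prod>j\<in>I-{k}. [:1, - y j:]))"
  have deg: "degree (\<Prod>j\<in>I-{k}. [:1, - y j:]) \<le> card I - 1" if "k \<in> I" for k
  proof -
    have "degree (\<Prod>j\<in>I-{k}. [:1, - y j:]) \<le> sum (degree \<circ> (\<lambda>j. [:1, - y j:])) (I-{k})"
      using fin by (intro degree_prod_sum_le) auto
    also have "\<dots> \<le> (\<Sum>j\<in>I-{k}. 1)"
      by (intro sum_mono) (simp add: degree_pCons_le)
    also have "\<dots> = card I - 1" using that fin by simp
    finally show ?thesis .
  qed
  have degf: "degree f \<le> card I - 1"
    unfolding f_def using fin deg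
    by (intro degree_sum_le) (auto intro: order.trans[OF degree_smult_le])
  have val: "poly f (x m) = (\<Prod>i\<in>I. P i)" if m: "m \<in> I" for m
  proof -
    have "poly f (x m) = (\<Sum>k\<in>I. (\<Prod>i\<in>I-{k}. P i) * (\<Prod>j\<in>I-{k}. 1 - x m * y j))"
      by (simp add: f_def poly_sum poly_prod)
    also have "\<dots> = (\<Sum>k\<in>I. if k = m then (\<Prod>i\<in>I. P i) else 0)"
    proof (rule sum.cong)
      fix k assume k: "k \<in> I"
      show "(\<Prod>i\<in>I-{k}. P i) * (\<Prod>j\<in>I-{k}. 1 - x m * y j) = (if k = m then (\<Prod>i\<in>I. P i) else 0)"
      proof (cases "k = m")
        case True
        then show ?thesis using prod.remove[OF fin m, of P] by (simp add: P_def mult.commute)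
      next
        case False
        then have "(\<Prod>j\<in>I-{k}. 1 - x m * y j) = 0"
          using fin m inv[OF m] by (intro prod_zero) (auto intro!: bexI[of _ m])
        then show ?thesis using False by simp
      qed
    qed simp
    also have "\<dots> = (\<Prod>i\<in>I. P i)" using fin m by simp
    finally show ?thesis .
  qed
  have "f = [:\<Prod>i\<in>I. P i:]"
  proof (rule ccontr)
    assume "f \<noteq> [:\<Prod>i\<in>I. P i:]"
    then have nz: "f - [:\<Prod>i\<in>I. P i:] \<noteq> 0" by simp
    have "card I = card (x ` I)" using inj by (simp add: card_image)
    also have "\<dots> \<le> card {z. poly (f - [:\<Prod>i\<in>I. P i:]) z = 0}"
      using nz val by (intro card_mono poly_roots_finite) auto
    also have "\<dots> \<le> degree (f - [:\<Prod>i\<in>I. P i:])"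
      using nz by (rule card_poly_roots_bound)
    also have "\<dots> \<le> card I - 1"
      using degf by (intro degree_diff_le) auto
    finally show False using fin ne card_gt_0_iff[of I] by linarith
  qed
  then have "poly f 0 = (\<Prod>i\<in>I. P i)" by simp
  moreover have "poly f 0 = (\<Sum>k\<in>I. \<Prod>i\<in>I-{k}. P i)"
    by (simp add: f_def poly_sum poly_prod)
  ultimately show ?thesis by (simp add: P_def)
qed

lemma xpow_add: "xpow i (j + k) = xpow i j * xpow i k"
  by (simp add: xpow_def mult_single single_add)

lemma xpow_0 [simp]: "xpow i 0 = 1"
  by (simp add: xpow_def)

lemma xpow_1_neg [simp]: "xpow i 1 * xpow i (-1) = 1"
  by (simp flip: xpow_add)

lemma inj_xpow_1: "inj_on (\<lambda>i. xpow i 1) I"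
proof (rule inj_onI)
  fix i j assume "xpow i 1 = xpow j 1"
  then have "Poly_Mapping.keys (xpow i 1) = Poly_Mapping.keys (xpow j 1)" by simp
  then have "Poly_Mapping.single i (1::int) = Poly_Mapping.single j 1"
    by (simp add: xpow_def)
  then have "Poly_Mapping.keys (Poly_Mapping.single i (1::int)) = Poly_Mapping.keys (Poly_Mapping.single j (1::int))"
    by simp
  then show "i = j" by simp
qed

text \<open>
  Arbitrary finite index sets are needed because the induction deletes variables one at a time.
\<close>

definition dyson :: "nat set \<Rightarrow> (nat \<Rightarrow> nat) \<Rightarrow> laurent_poly" where
  "dyson I a = (\<Prod>i\<in>I. (\<Prod>j\<in>I-{i}. 1 - xpow i 1 * xpow j (-1)) ^ a i)"

lemma dyson_product_eq: "dyson_product n a = dyson {1..n} a"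
proof -
  have "dyson {1..n} a = (\<Prod>i\<in>{1..n}. \<Prod>j\<in>{1..n}-{i}. (1 - xpow i 1 * xpow j (-1)) ^ a i)"
    by (simp add: dyson_def prod_power_distrib)
  also have "\<dots> = (\<Prod>(i, j)\<in>Sigma {1..n} (\<lambda>i. {1..n}-{i}). (1 - xpow i 1 * xpow j (-1)) ^ a i)"
    by (rule prod.Sigma) auto
  also have "Sigma {1..n} (\<lambda>i. {1..n}-{i}) = {(i, j). i \<in> {1..n} \<and> j \<in> {1..n} \<and> i \<noteq> j}"
    by auto
  finally show ?thesis by (simp add: dyson_product_def)
qed

text \<open>
  All exponents being positive, the product of all factors \<open>1 - x\<^sub>i / x\<^sub>j\<close> can be split off
  the Dyson product; replacing it by the sum in \<open>good_identity\<close> turns each summand into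
  a Dyson product with one exponent lowered.
\<close>

lemma dyson_recurrence:
  assumes fin: "finite I" and ne: "I \<noteq> {}" and pos: "\<And>k. k \<in> I \<Longrightarrow> a k > 0"
  shows "dyson I a = (\<Sum>k\<in>I. dyson I (a(k := a k - 1)))"
proof -
  define P :: "nat \<Rightarrow> laurent_poly" where "P i = (\<Prod>j\<in>I-{i}. 1 - xpow i 1 * xpow j (-1))" for i
  define Q where "Q = (\<Prod>i\<in>I. P i ^ (a i - 1))"
  have lower: "dyson I (a(k := a k - 1)) = (\<Prod>i\<in>I-{k}. P i) * Q" if k: "k \<in> I" for k
  proof -
    have "dyson I (a(k := a k - 1)) = P k ^ (a k - 1) * (\<Prod>i\<in>I-{k}. P i ^ a i)"
      by (simp add: dyson_def P_def prod.remove[OF fin k])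
    also have "(\<Prod>i\<in>I-{k}. P i ^ a i) = (\<Prod>i\<in>I-{k}. P i * P i ^ (a i - 1))"
      using pos by (intro prod.cong) (auto simp flip: power_Suc)
    finally show ?thesis
      by (simp only: Q_def prod.remove[OF fin k, of "\<lambda>i. P i ^ (a i - 1)"] prod.distrib mult_ac)
  qed
  have "dyson I a = (\<Prod>i\<in>I. P i * P i ^ (a i - 1))"
    unfolding dyson_def P_def using pos by (intro prod.cong) (auto simp flip: power_Suc)
  also have "\<dots> = (\<Prod>i\<in>I. P i) * Q"
    by (simp add: Q_def prod.distrib)
  also have "(\<Prod>i\<in>I. P i) = (\<Sum>k\<in>I. \<Prod>i\<in>I-{k}. P i)"
    unfolding P_def by (rule good_identity[symmetric]) (use fin ne inj_xpow_1 in auto)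
  also have "\<dots> * Q = (\<Sum>k\<in>I. dyson I (a(k := a k - 1)))"
    unfolding sum_distrib_right by (rule sum.cong) (simp_all only: lower)
  finally show ?thesis .
qed

text \<open>
  When \<open>a k = 0\<close>, the variable \<open>x\<^sub>k\<close> occurs only in denominators, and all of it sits in the
  first factor below.
\<close>

lemma dyson_remove:
  assumes fin: "finite I" and k: "k \<in> I" "a k = 0"
  shows "dyson I a = (\<Prod>i\<in>I-{k}. (1 - xpow i 1 * xpow k (-1)) ^ a i) * dyson (I-{k}) a"
proof -
  have "dyson I a = (\<Prod>i\<in>I-{k}. (\<Prod>j\<in>I-{i}. 1 - xpow i 1 * xpow j (-1)) ^ a i)"
    using k by (simp add: dyson_def prod.remove[OF fin k(1)])
  also have "\<dots> = (\<Prod>i\<in>I-{k}. (1 - xpow i 1 * xpow k (-1)) ^ a i * (\<Prod>j\<in>I-{k}-{i}. 1 - xpow i 1 * xpow j (-1)) ^ a i)"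
  proof (rule prod.cong)
    fix i assume i: "i \<in> I - {k}"
    then have "I - {i} = insert k (I - {k} - {i})" using k by auto
    then show "(\<Prod>j\<in>I-{i}. 1 - xpow i 1 * xpow j (-1)) ^ a i = (1 - xpow i 1 * xpow k (-1)) ^ a i * (\<Prod>j\<in>I-{k}-{i}. 1 - xpow i 1 * xpow j (-1)) ^ a i"
      using fin by (simp add: power_mult_distrib)
  qed simp
  finally show ?thesis by (simp add: dyson_def prod.distrib)
qed

section \<open>Constant terms when a variable has exponent zero\<close>

lemma CT_add: "CT (f + g) = CT f + CT g"
  by (simp add: CT_def lookup_add)

lemma CT_diff: "CT (f - g) = CT f - CT g"
  by (simp add: CT_def lookup_minus)

lemma CT_sum: "CT (sum f A) = (\<Sum>i\<in>A. CT (f i))"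
  by (induction A rule: infinite_finite_induct) (simp_all add: CT_add, simp_all add: CT_def)

lemma CT_of_nat_mult: "CT (of_nat c * f) = of_nat c * CT f"
  by (induction c) (simp_all add: CT_add algebra_simps, simp add: CT_def)

text \<open>
  Bookkeeping for the exponents of a single variable \<open>x\<^sub>k\<close>. A set \<open>S\<close> of permitted
  exponents, rather than a degree, lets the same rules cover both a fixed exponent \<open>{d}\<close> and
  a bound \<open>{..d}\<close>.
\<close>

definition exps_in :: "nat \<Rightarrow> int set \<Rightarrow> laurent_poly \<Rightarrow> bool" where
  "exps_in k S f \<longleftrightarrow> (\<forall>m\<in>Poly_Mapping.keys f. Poly_Mapping.lookup m k \<in> S)"

lemma CT_eq_0: "exps_in k S f \<Longrightarrow> 0 \<notin> S \<Longrightarrow> CT f = 0"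
  unfolding exps_in_def CT_def by (metis in_keys_iff lookup_zero)

lemma exps_in_mult:
  assumes "exps_in k S f" "exps_in k T g" "\<And>s t. s \<in> S \<Longrightarrow> t \<in> T \<Longrightarrow> s + t \<in> U"
  shows "exps_in k U (f * g)"
  using assms keys_mult[of f g] unfolding exps_in_def by (fastforce simp: lookup_add)

lemma exps_in_add: "exps_in k S f \<Longrightarrow> exps_in k S g \<Longrightarrow> exps_in k S (f + g)"
  using keys_add[of f g] unfolding exps_in_def by blast

lemma exps_in_diff: "exps_in k S f \<Longrightarrow> exps_in k S g \<Longrightarrow> exps_in k S (f - g)"
  using keys_diff[of f g] unfolding exps_in_def by blast

lemma exps_in_xpow: "(if i = k then e else 0) \<in> S \<Longrightarrow> exps_in k S (xpow i e)"
  by (auto simp: exps_in_def xpow_def lookup_single when_def)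

lemma exps_in_0: "exps_in k S 0" by (simp add: exps_in_def)

lemma exps_in_1: "0 \<in> S \<Longrightarrow> exps_in k S 1"
  by (simp add: exps_in_def)

lemma exps_in_power:
  assumes "0 \<in> S" "\<And>s t. s \<in> S \<Longrightarrow> t \<in> S \<Longrightarrow> s + t \<in> S" "exps_in k S f"
  shows "exps_in k S (f ^ n)"
  using assms by (induction n) (auto intro: exps_in_1 exps_in_mult)

lemma exps_in_prod:
  assumes "0 \<in> S" "\<And>s t. s \<in> S \<Longrightarrow> t \<in> S \<Longrightarrow> s + t \<in> S" "\<And>i. i \<in> A \<Longrightarrow> exps_in k S (f i)"
  shows "exps_in k S (prod f A)"
  using assms(3)
  by (induction A rule: infinite_finite_induct) (auto intro: exps_in_1 exps_in_mult assms)

lemma exps_in_dyson: "k \<notin> I \<Longrightarrow> exps_in k {0} (dyson I a)"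
  unfolding dyson_def
  by (intro exps_in_prod exps_in_power exps_in_diff exps_in_1 exps_in_mult[where S="{0}" and T="{0}"] exps_in_xpow) auto

text \<open>
  \<open>P = 1 - E / x\<^sub>k + (E\<^sup>2 - F) / (2 * x\<^sub>k\<^sup>2)\<close> up to terms of order at least 3 in \<open>1 / x\<^sub>k\<close>.
  If \<open>P\<close> is a product of factors \<open>1 - u / x\<^sub>k\<close>, then \<open>E\<close> and \<open>F\<close> are the first and second power
  sums of the \<open>u\<close>, and the last coefficient is their second elementary symmetric
  function. Doubling the equation avoids a division in the ring.
\<close>

definition expands :: "nat \<Rightarrow> laurent_poly \<Rightarrow> laurent_poly \<Rightarrow> laurent_poly \<Rightarrow> bool" where
  "expands k P E F \<longleftrightarrow> exps_in k {0} E \<and> exps_in k {0} F \<and>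
     (\<exists>R. exps_in k {..-3} R \<and> 2 * P = 2 - 2 * (xpow k (-1) * E) + xpow k (-2) * (E\<^sup>2 - F) + R)"

lemma expands_mult:
  assumes "expands k P E F" "exps_in k {0} u"
  shows "expands k (P * (1 - u * xpow k (-1))) (E + u) (F + u\<^sup>2)"
proof -
  from assms(1) obtain R where E: "exps_in k {0} E" and F: "exps_in k {0} F" and R: "exps_in k {..-3} R"
    and eq: "2 * P = 2 - 2 * (xpow k (-1) * E) + xpow k (-2) * (E\<^sup>2 - F) + R"
    unfolding expands_def by blast
  define y where "y = xpow k (-1)"
  have y2: "xpow k (-2) = y\<^sup>2" by (simp add: y_def power2_eq_square flip: xpow_add)
  define R' where "R' = R - (u * y) * R - (y * y * y) * (u * (E\<^sup>2 - F))"
  have y: "exps_in k {-1} y" by (auto simp: y_def intro: exps_in_xpow)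
  have sq: "exps_in k {0} (f\<^sup>2)" if "exps_in k {0} f" for f
    using that by (intro exps_in_power) auto
  have y3: "exps_in k {-3} (y * y * y)"
    by (rule exps_in_mult[where S="{-2}" and T="{-1}"], rule exps_in_mult[where S="{-1}" and T="{-1}"]) (auto intro: y)
  have uy: "exps_in k {-1} (u * y)"
    by (rule exps_in_mult[OF assms(2) y]) auto
  have uEF: "exps_in k {0} (u * (E\<^sup>2 - F))"
    by (rule exps_in_mult[OF assms(2) exps_in_diff[OF sq[OF E] F]]) auto
  have "exps_in k {..-3} R'"
    unfolding R'_def
    by (intro exps_in_diff R exps_in_mult[OF uy R] exps_in_mult[OF y3 uEF]) auto
  moreover have "2 * (P * (1 - u * y)) = 2 - 2 * (y * (E + u)) + y\<^sup>2 * ((E + u)\<^sup>2 - (F + u\<^sup>2)) + R'"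
  proof -
    have "2 * (P * (1 - u * y)) = (2 * P) * (1 - u * y)" by (simp only: mult.assoc)
    also have "\<dots> = (2 - 2 * (y * E) + y\<^sup>2 * (E\<^sup>2 - F) + R) * (1 - u * y)"
      using eq by (simp add: y2 flip: y_def)
    also have "\<dots> = 2 - 2 * (y * (E + u)) + y\<^sup>2 * ((E + u)\<^sup>2 - (F + u\<^sup>2)) + R'"
      unfolding R'_def by algebra
    finally show ?thesis .
  qed
  ultimately show ?thesis
    unfolding expands_def y2
    using E F assms(2) sq by (auto simp flip: y_def intro!: exps_in_add)
qed

lemma expands_power:
  assumes "expands k P E F" "exps_in k {0} u"
  shows "expands k (P * (1 - u * xpow k (-1)) ^ m) (E + of_nat m * u) (F + of_nat m * u\<^sup>2)"
proof (induction m)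
  case (Suc m)
  from expands_mult[OF this assms(2)] show ?case by (simp add: algebra_simps)
qed (use assms in simp)

lemma expands_prod:
  assumes "finite J" "k \<notin> J"
  shows "expands k (\<Prod>i\<in>J. (1 - xpow i 1 * xpow k (-1)) ^ a i)
           (\<Sum>i\<in>J. of_nat (a i) * xpow i 1) (\<Sum>i\<in>J. of_nat (a i) * (xpow i 1)\<^sup>2)"
  using assms
proof (induction J)
  case empty
  show ?case by (auto simp: expands_def exps_in_0 intro!: exI[of _ 0])
next
  case (insert j J)
  have "expands k (\<Prod>i\<in>J. (1 - xpow i 1 * xpow k (-1)) ^ a i)
           (\<Sum>i\<in>J. of_nat (a i) * xpow i 1) (\<Sum>i\<in>J. of_nat (a i) * (xpow i 1)\<^sup>2)"
    using insert by auto
  moreover have "exps_in k {0} (xpow j 1)"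
    using insert by (auto intro!: exps_in_xpow)
  ultimately have "expands k ((\<Prod>i\<in>J. (1 - xpow i 1 * xpow k (-1)) ^ a i) * (1 - xpow j 1 * xpow k (-1)) ^ a j)
           ((\<Sum>i\<in>J. of_nat (a i) * xpow i 1) + of_nat (a j) * xpow j 1) ((\<Sum>i\<in>J. of_nat (a i) * (xpow i 1)\<^sup>2) + of_nat (a j) * (xpow j 1)\<^sup>2)"
    by (rule expands_power)
  then show ?case using insert by (simp add: ac_simps)
qed

text \<open>
  With \<open>a k = 0\<close> the Dyson product has no positive power of \<open>x\<^sub>k\<close> that could make up for the
  negative power in \<open>g\<close>.
\<close>

lemma CT_times_dyson_vanishing:
  assumes fin: "finite I" and k: "k \<in> I" "a k = 0" and g: "exps_in k {e} g" and e: "e < 0"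
  shows "CT (g * dyson I a) = 0"
proof -
  have "exps_in k {..0} (\<Prod>i\<in>I-{k}. (1 - xpow i 1 * xpow k (-1)) ^ a i)"
    by (intro exps_in_prod exps_in_power exps_in_diff exps_in_1 exps_in_mult[where S="{0}" and T="{-1}"] exps_in_xpow) auto
  then have "exps_in k {..0} (dyson I a)"
    using dyson_remove[of I k a] fin k
    by (auto intro!: exps_in_mult[OF _ exps_in_dyson])
  then have "exps_in k {..<0} (g * dyson I a)"
    by (rule exps_in_mult[OF g]) (use e in auto)
  then show ?thesis by (rule CT_eq_0) simp
qed

text \<open>
  Reading off the coefficients of \<open>x\<^sub>k\<^sup>0\<close>, \<open>x\<^sub>k\<^sup>-\<^sup>1\<close> and \<open>x\<^sub>k\<^sup>-\<^sup>2\<close> in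
  \<open>\<Prod>i. (1 - x\<^sub>i / x\<^sub>k) ^ a i\<close> reduces a constant term with \<open>a k = 0\<close> to constant terms over
  \<open>I - {k}\<close>. Each factor \<open>x\<^sub>k\<close> is traded for some \<open>x\<^sub>i\<close>, so the total degree is preserved and,
  for \<open>g\<close> a power of \<open>x\<^sub>r\<close> times further variables, only a finite list of shapes can arise.
\<close>

lemma CT_dyson_remove:
  assumes fin: "finite I" and k: "k \<in> I" "a k = 0" and g: "exps_in k {0} g"
  shows CT_dyson_remove_0: "CT (g * dyson I a) = CT (g * dyson (I-{k}) a)"
    and CT_dyson_remove_1: "CT (xpow k 1 * g * dyson I a) =
           - (\<Sum>i\<in>I-{k}. of_nat (a i) * CT (xpow i 1 * g * dyson (I-{k}) a))"
    and CT_dyson_remove_2: "2 * CT (xpow k 1 * xpow k 1 * g * dyson I a) =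
           (\<Sum>i\<in>I-{k}. \<Sum>j\<in>I-{k}. of_nat (a i) * of_nat (a j) * CT (xpow i 1 * xpow j 1 * g * dyson (I-{k}) a))
           - (\<Sum>i\<in>I-{k}. of_nat (a i) * CT (xpow i 1 * xpow i 1 * g * dyson (I-{k}) a))"
proof -
  define P where "P = (\<Prod>i\<in>I-{k}. (1 - xpow i 1 * xpow k (-1)) ^ a i)"
  define E :: laurent_poly where "E = (\<Sum>i\<in>I-{k}. of_nat (a i) * xpow i 1)"
  define F :: laurent_poly where "F = (\<Sum>i\<in>I-{k}. of_nat (a i) * (xpow i 1)\<^sup>2)"
  define h where "h = g * dyson (I-{k}) a"
  have "expands k P E F"
    unfolding P_def E_def F_def using fin by (intro expands_prod) auto
  then obtain R where E: "exps_in k {0} E" and F: "exps_in k {0} F" and R: "exps_in k {..-3} R"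
    and P: "2 * P = 2 - 2 * (xpow k (-1) * E) + xpow k (-2) * (E\<^sup>2 - F) + R"
    unfolding expands_def by blast
  have h: "exps_in k {0} h"
    unfolding h_def by (rule exps_in_mult[OF g exps_in_dyson]) auto
  have hE: "exps_in k {0} (E * h)" by (rule exps_in_mult[OF E h]) auto
  have E2: "exps_in k {0} (E\<^sup>2)" by (rule exps_in_power[OF _ _ E]) auto
  have hEF: "exps_in k {0} ((E\<^sup>2 - F) * h)"
    by (rule exps_in_mult[OF exps_in_diff[OF E2 F] h]) auto
  have hR: "exps_in k {..-3} (R * h)" by (rule exps_in_mult[OF R h]) auto
  have shift: "exps_in k T (xpow k e * f)" if "exps_in k S f" "\<And>s. s \<in> S \<Longrightarrow> e + s \<in> T" for e S T f
    by (rule exps_in_mult[OF exps_in_xpow[where S="{e}"] that(1)]) (use that(2) in auto)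
  have zero: "CT (xpow k e * f) = 0" if "exps_in k {0} f" "e \<noteq> 0" for e f
    by (rule CT_eq_0[OF shift[OF that(1), where T="{e}"]]) (use that(2) in auto)
  \<comment> \<open>For \<open>e \<le> 2\<close> the remainder of order 3 still has only negative powers of \<open>x\<^sub>k\<close>.\<close>
  have main: "2 * CT (xpow k e * g * dyson I a) =
     2 * CT (xpow k e * h) - 2 * CT (xpow k (e - 1) * (E * h)) + CT (xpow k (e - 2) * ((E\<^sup>2 - F) * h))"
    if "e \<le> 2" for e
  proof -
    have "2 * CT (xpow k e * g * dyson I a) = of_nat 2 * CT (xpow k e * g * dyson I a)" by simp
    also have "\<dots> = CT (of_nat 2 * (xpow k e * g * dyson I a))"
      by (simp only: CT_of_nat_mult)
    also have "of_nat 2 * (xpow k e * g * dyson I a) = xpow k e * (2 * P) * h"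
      using dyson_remove[of I k a] fin k by (simp add: h_def P_def mult_ac)
    also have "\<dots> = of_nat 2 * (xpow k e * h) - of_nat 2 * (xpow k (e - 1) * (E * h)) + xpow k (e - 2) * ((E\<^sup>2 - F) * h) + xpow k e * (R * h)"
      unfolding P using xpow_add[of k e "-1"] xpow_add[of k e "-2"] by (simp add: algebra_simps)
    also have "CT \<dots> = 2 * CT (xpow k e * h) - 2 * CT (xpow k (e - 1) * (E * h)) + CT (xpow k (e - 2) * ((E\<^sup>2 - F) * h)) + CT (xpow k e * (R * h))"
      unfolding CT_add CT_diff CT_of_nat_mult by simp
    also have "CT (xpow k e * (R * h)) = 0"
      by (rule CT_eq_0[OF shift[OF hR, where T="{..-1}"]]) (use that in auto)
    finally show ?thesis by simp
  qed
  show "CT (g * dyson I a) = CT (g * dyson (I-{k}) a)"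
    using main[of 0] zero[OF hE] zero[OF hEF] by (simp add: h_def)
  show "CT (xpow k 1 * g * dyson I a) =
           - (\<Sum>i\<in>I-{k}. of_nat (a i) * CT (xpow i 1 * g * dyson (I-{k}) a))"
  proof -
    have "CT (xpow k 1 * g * dyson I a) = - CT (E * h)"
      using main[of 1] zero[OF h] zero[OF hEF] by simp
    also have "E * h = (\<Sum>i\<in>I-{k}. of_nat (a i) * (xpow i 1 * g * dyson (I-{k}) a))"
      unfolding E_def h_def sum_distrib_right by (simp only: mult_ac)
    finally show ?thesis by (simp only: CT_sum CT_of_nat_mult)
  qed
  show "2 * CT (xpow k 1 * xpow k 1 * g * dyson I a) =
           (\<Sum>i\<in>I-{k}. \<Sum>j\<in>I-{k}. of_nat (a i) * of_nat (a j) * CT (xpow i 1 * xpow j 1 * g * dyson (I-{k}) a))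
           - (\<Sum>i\<in>I-{k}. of_nat (a i) * CT (xpow i 1 * xpow i 1 * g * dyson (I-{k}) a))"
  proof -
    have "xpow k 1 * xpow k 1 = xpow k 2" by (simp flip: xpow_add)
    then have "2 * CT (xpow k 1 * xpow k 1 * g * dyson I a) = CT (E\<^sup>2 * h) - CT (F * h)"
      using main[of 2] zero[OF h] zero[OF hE] by (simp add: left_diff_distrib CT_diff)
    also have "E\<^sup>2 * h = (\<Sum>i\<in>I-{k}. \<Sum>j\<in>I-{k}. of_nat (a i) * (of_nat (a j) * (xpow i 1 * xpow j 1 * g * dyson (I-{k}) a)))"
      unfolding E_def h_def power2_eq_square sum_product by (simp only: sum_distrib_right) (simp only: mult_ac)
    also have "F * h = (\<Sum>i\<in>I-{k}. of_nat (a i) * (xpow i 1 * xpow i 1 * g * dyson (I-{k}) a))"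
      unfolding F_def h_def power2_eq_square sum_distrib_right by (simp only: mult_ac)
    finally show ?thesis by (simp only: CT_sum CT_of_nat_mult mult.assoc)
  qed
qed

section \<open>Multinomial coefficients and averaging\<close>

definition wt :: "nat set \<Rightarrow> (nat \<Rightarrow> nat) \<Rightarrow> rat" where
  "wt J a = (\<Sum>i\<in>J. rat_of_nat (a i))"

lemma wt_insert [simp]: "finite J \<Longrightarrow> k \<notin> J \<Longrightarrow> wt (insert k J) a = rat_of_nat (a k) + wt J a"
  by (simp add: wt_def)

lemma wt_remove: "finite J \<Longrightarrow> k \<in> J \<Longrightarrow> wt J a = rat_of_nat (a k) + wt (J-{k}) a"
  by (simp add: wt_def sum.remove)

lemma wt_nonneg: "0 \<le> wt J a"
  by (simp add: wt_def sum_nonneg)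

lemma wt_le: "finite J \<Longrightarrow> k \<in> J \<Longrightarrow> rat_of_nat (a k) \<le> wt J a"
  using wt_remove[of J k a] wt_nonneg[of "J-{k}" a] by simp

lemma wt_lower_in: "finite J \<Longrightarrow> k \<in> J \<Longrightarrow> a k > 0 \<Longrightarrow> wt J (a(k := a k - 1)) = wt J a - 1"
  by (simp add: wt_def sum.remove of_nat_diff)

lemma wt_lower_out: "k \<notin> J \<Longrightarrow> wt J (a(k := x)) = wt J a"
  unfolding wt_def by (rule sum.cong) auto

definition multinomial :: "nat set \<Rightarrow> (nat \<Rightarrow> nat) \<Rightarrow> rat" where
  "multinomial I a = fact (sum a I) / (\<Prod>i\<in>I. fact (a i))"

lemma multinomial_remove: "finite I \<Longrightarrow> k \<in> I \<Longrightarrow> a k = 0 \<Longrightarrow> multinomial (I-{k}) a = multinomial I a"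
  by (simp add: multinomial_def sum.remove[of I k] prod.remove[of I k])

lemma multinomial_lower:
  assumes fin: "finite I" and k: "k \<in> I" "a k > 0"
  shows "wt I a * multinomial I (a(k := a k - 1)) = of_nat (a k) * multinomial I a"
proof -
  obtain m where m: "a k = Suc m" using k by (cases "a k") auto
  define S where "S = m + sum a (I-{k})"
  define Q where "Q = (\<Prod>i\<in>I-{k}. fact (a i) :: rat)"
  have upper: "sum a I = Suc S" "(\<Prod>i\<in>I. fact (a i) :: rat) = fact (Suc m) * Q"
    by (simp_all add: sum.remove[OF fin k(1)] prod.remove[OF fin k(1)] m S_def Q_def del: fact_Suc)
  have lower: "sum (a(k := m)) I = S" "(\<Prod>i\<in>I. fact ((a(k := m)) i) :: rat) = fact m * Q"
    by (simp_all add: sum.remove[OF fin k(1)] prod.remove[OF fin k(1)] S_def Q_def)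
  have w: "wt I a = rat_of_nat (Suc S)" by (simp add: wt_def flip: upper(1))
  have nz: "rat_of_nat (Suc m) \<noteq> 0" by (simp del: of_nat_Suc)
  have "multinomial I (a(k := a k - 1)) = fact S / (fact m * Q)"
    unfolding m diff_Suc_1 multinomial_def lower by (rule refl)
  moreover have "multinomial I a = (of_nat (Suc S) * fact S) / ((of_nat (Suc m) * fact m) * Q)"
    unfolding multinomial_def upper by (simp only: fact_Suc)
  ultimately show ?thesis
    unfolding w m using nz by (simp del: of_nat_Suc)
qed

text \<open>
  If \<open>G a = g a * multinomial I a\<close>, then, for positive exponents, Good's recursion \<open>G a = (\<Sum>k\<in>I. G (a - e\<^sub>k))\<close> is
  equivalent to this mean value property of \<open>g\<close>, because
  \<open>multinomial I (a - e\<^sub>k) = (a k / wt I a) * multinomial I a\<close>. The property is linear in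
  \<open>g\<close>, so it can be checked on the simple pieces of a formula.
\<close>

definition harmonic :: "nat set \<Rightarrow> (nat \<Rightarrow> nat) \<Rightarrow> ((nat \<Rightarrow> nat) \<Rightarrow> rat) \<Rightarrow> bool" where
  "harmonic I a g \<longleftrightarrow> (\<Sum>k\<in>I. of_nat (a k) * g (a(k := a k - 1))) = wt I a * g a"

lemma harmonic_const: "harmonic I a (\<lambda>_. c)"
  by (simp add: harmonic_def wt_def sum_distrib_right)

lemma harmonic_add: "harmonic I a f \<Longrightarrow> harmonic I a g \<Longrightarrow> harmonic I a (\<lambda>a. f a + g a)"
  by (simp add: harmonic_def distrib_left sum.distrib)

lemma harmonic_diff: "harmonic I a f \<Longrightarrow> harmonic I a g \<Longrightarrow> harmonic I a (\<lambda>a. f a - g a)"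
  by (simp add: harmonic_def right_diff_distrib sum_subtractf)

lemma harmonic_uminus: "harmonic I a f \<Longrightarrow> harmonic I a (\<lambda>a. - f a)"
  by (simp add: harmonic_def sum_negf)

lemma harmonic_sum: "(\<And>i. i \<in> J \<Longrightarrow> harmonic I a (f i)) \<Longrightarrow> harmonic I a (\<lambda>a. \<Sum>i\<in>J. f i a)"
  by (induction J rule: infinite_finite_induct) (auto intro: harmonic_add harmonic_const)

text \<open>
  The induction step at positive exponents: once a conjectured formula satisfies the recursion, its
  truth for the lowered exponents gives its truth at \<open>a\<close>.
\<close>

lemma CT_recurrence_step:
  assumes fin: "finite I" and ne: "I \<noteq> {}" and pos: "\<And>k. k \<in> I \<Longrightarrow> a k > 0"
    and IH: "\<And>k. k \<in> I \<Longrightarrow> CT (m * dyson I (a(k := a k - 1))) = g (a(k := a k - 1)) * multinomial I (a(k := a k - 1))"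
    and harm: "harmonic I a g"
  shows "CT (m * dyson I a) = g a * multinomial I a"
proof -
  have w: "wt I a > 0"
    using wt_le[OF fin, of _ a] ne pos by (metis all_not_in_conv of_nat_0_less_iff order_less_le_trans)
  have "CT (m * dyson I a) = (\<Sum>k\<in>I. g (a(k := a k - 1)) * multinomial I (a(k := a k - 1)))"
    by (subst dyson_recurrence[OF fin ne pos]) (simp_all only: sum_distrib_left CT_sum IH cong: sum.cong)
  then have "wt I a * CT (m * dyson I a) = (\<Sum>k\<in>I. g (a(k := a k - 1)) * (wt I a * multinomial I (a(k := a k - 1))))"
    by (simp only: sum_distrib_left mult_ac)
  also have "\<dots> = (\<Sum>k\<in>I. of_nat (a k) * g (a(k := a k - 1))) * multinomial I a"
    unfolding sum_distrib_right
    by (rule sum.cong) (simp_all only: multinomial_lower fin pos mult_ac)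
  also have "\<dots> = wt I a * (g a * multinomial I a)"
    using harm by (simp only: harmonic_def mult_ac)
  finally show ?thesis using w by simp
qed

text \<open>
  The measure \<open>card I + sum a I\<close> decreases both when an index is deleted and when an exponent is
  lowered: the two reductions available at a zero exponent and at positive exponents.
\<close>

lemma dyson_induct [consumes 1, case_names step]:
  assumes fin: "finite I"
    and step: "\<And>I a. finite I \<Longrightarrow> (\<And>k. k \<in> I \<Longrightarrow> P (I-{k}) a) \<Longrightarrow>
      (\<And>k. k \<in> I \<Longrightarrow> a k > 0 \<Longrightarrow> P I (a(k := a k - 1))) \<Longrightarrow> P I a"
  shows "P I (a :: nat \<Rightarrow> nat)"
  using fin
proof (induction "card I + sum a I" arbitrary: I a rule: less_induct)
  case less
  show ?case
  proof (rule step)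
    fix k assume k: "k \<in> I"
    have s: "sum f I = f k + sum f (I-{k})" for f :: "nat \<Rightarrow> nat"
      using sum.remove[OF less.prems k] by simp
    have "card (I-{k}) < card I"
      using less.prems k by (rule card_Diff1_less)
    then show "P (I-{k}) a"
      using less.prems by (intro less.hyps) (simp_all add: s[of a])
    assume "a k > 0"
    then show "P I (a(k := a k - 1))"
      using less.prems by (intro less.hyps) (simp_all add: s)
  qed (use less.prems in auto)
qed

text \<open>
  Dyson's conjecture by Good's argument: the constant function 1 is harmonic, and a zero
  exponent can simply be dropped. The formulas below need it because a ratio \<open>x\<^sub>r / x\<^sub>r\<close>
  arises when a variable is deleted.
\<close>

theorem CT_dyson:
  assumes "finite I"
  shows "CT (dyson I a) = multinomial I a"
  using assms
proof (induction I a rule: dyson_induct)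
  case (step I a)
  note fin = step(1) and IH = step(2,3)
  consider "I = {}" | k where "k \<in> I" "a k = 0" | "I \<noteq> {}" "\<And>k. k \<in> I \<Longrightarrow> a k > 0" by blast
  then show ?case
  proof cases
    case 1
    then show ?thesis by (simp add: dyson_def multinomial_def CT_def)
  next
    case (2 k)
    then have "CT (dyson I a) = CT (dyson (I-{k}) a)"
      using CT_dyson_remove_0[of I k a 1] fin by (simp add: exps_in_1)
    then show ?thesis using IH(1) fin 2 by (simp add: multinomial_remove)
  next
    case 3
    have "CT (1 * dyson I a) = 1 * multinomial I a"
      by (rule CT_recurrence_step[where g = "\<lambda>_. 1", OF fin 3])
        (simp_all only: mult_1 IH(2) 3 harmonic_const)
    then show ?thesis by simp
  qed
qed

section \<open>Harmonic functions of the exponents\<close>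

text \<open>
  This function depends only on \<open>a r\<close> and \<open>b\<close>, the weight of the other indices. Lowering any of
  those others has the same effect \<open>b \<mapsto> b - 1\<close>, so they act as one index of weight \<open>b\<close>, and
  the mean value property is a rational identity in two variables. It uses \<open>b / b = 1\<close>, which
  is why \<open>b\<close> must be positive.
\<close>

lemma harmonic_ratio:
  assumes fin: "finite I" and r: "r \<in> I" and pos: "\<And>k. k \<in> I \<Longrightarrow> a k > 0" and b: "wt (I-{r}) a > 0"
  shows "harmonic I a (\<lambda>a. of_nat (a r) / (1 + wt (I-{r}) a))"
proof -
  have "(\<Sum>k\<in>I-{r}. of_nat (a k) * (of_nat ((a(k := a k - 1)) r) / (1 + wt (I-{r}) (a(k := a k - 1)))))
      = (\<Sum>k\<in>I-{r}. of_nat (a k) * (of_nat (a r) / wt (I-{r}) a))"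
    using fin pos by (intro sum.cong) (auto simp add: wt_lower_in simp del: One_nat_def)
  also have "\<dots> = wt (I-{r}) a * (of_nat (a r) / wt (I-{r}) a)"
    by (simp only: wt_def sum_distrib_right)
  finally show ?thesis
    using pos[OF r] b wt_nonneg[of "I-{r}" a] unfolding harmonic_def
    by (simp add: sum.remove[OF fin r] wt_remove[OF fin r] wt_lower_out of_nat_diff field_simps)
qed

lemma harmonic_falling_ratio:
  assumes fin: "finite I" and r: "r \<in> I" and pos: "\<And>k. k \<in> I \<Longrightarrow> a k > 0" and b: "wt (I-{r}) a > 0"
  shows "harmonic I a (\<lambda>a. of_nat (a r) * (of_nat (a r) - 1) / ((1 + wt (I-{r}) a) * (2 + wt (I-{r}) a)))"
    (is "harmonic I a ?g")
proof -
  define u b where "u = rat_of_nat (a r)" and "b = wt (I-{r}) a"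
  have pb: "b > 0" using b by (simp add: b_def)
  have "(\<Sum>k\<in>I-{r}. of_nat (a k) * ?g (a(k := a k - 1)))
      = (\<Sum>k\<in>I-{r}. of_nat (a k) * (u * (u - 1) / (b * (1 + b))))"
    using fin pos by (intro sum.cong) (auto simp add: wt_lower_in u_def b_def simp del: One_nat_def)
  also have "\<dots> = b * (u * (u - 1) / (b * (1 + b)))"
    by (simp only: b_def wt_def sum_distrib_right)
  finally have 1: "(\<Sum>k\<in>I-{r}. of_nat (a k) * ?g (a(k := a k - 1))) = b * (u * (u - 1) / (b * (1 + b)))" .
  have 2: "?g (a(r := a r - 1)) = (u - 1) * (u - 2) / ((1 + b) * (2 + b))"
    using pos[OF r] by (simp add: wt_lower_out of_nat_diff u_def b_def)
  have "u * ((u - 1) * (u - 2) / ((1 + b) * (2 + b))) + b * (u * (u - 1) / (b * (1 + b)))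
      = (u + b) * (u * (u - 1) / ((1 + b) * (2 + b)))"
    using pb by (simp add: divide_simps) algebra
  then show ?thesis
    unfolding harmonic_def sum.remove[OF fin r] 1 2 unfolding wt_remove[OF fin r] by (simp only: u_def b_def)
qed

text \<open>
  Here three groups of indices are to be distinguished: \<open>r\<close>, \<open>i\<close>, and the rest, of weight \<open>c\<close>.
  Lowering an index of the rest replaces the denominator \<open>1 + c\<close> by \<open>c\<close>, so \<open>c\<close> must
  be positive. In the application the rest contains \<open>s\<close>.
\<close>

lemma harmonic_cross_ratio:
  assumes fin: "finite I" and r: "r \<in> I" and i: "i \<in> I" "i \<noteq> r" and pos: "\<And>k. k \<in> I \<Longrightarrow> a k > 0"
    and c: "wt (I-{r}-{i}) a > 0"
  shows "harmonic I a (\<lambda>a. of_nat (a r) * of_nat (a i) * (1 + wt (I-{r}) a + of_nat (a r)) /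
      ((1 + wt (I-{r}) a) * (2 + wt (I-{r}) a) * (1 + wt (I-{r}) a - of_nat (a i))))"
    (is "harmonic I a ?g")
proof -
  define u v c where "u = rat_of_nat (a r)" and "v = rat_of_nat (a i)" and "c = wt (I-{r}-{i}) a"
  have pv: "v > 0" using pos[OF i(1)] by (simp add: v_def)
  have pc: "c > 0" using c by (simp add: c_def)
  have fr: "finite (I-{r})" and ir: "i \<in> I-{r}" using fin i by auto
  have g: "?g a' = of_nat (a' r) * of_nat (a' i) * (1 + of_nat (a' i) + wt (I-{r}-{i}) a' + of_nat (a' r)) /
      ((1 + of_nat (a' i) + wt (I-{r}-{i}) a') * (2 + of_nat (a' i) + wt (I-{r}-{i}) a') * (1 + wt (I-{r}-{i}) a'))" for a'
    by (simp add: wt_remove[OF fr ir] add_ac)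
  have "(\<Sum>k\<in>I-{r}-{i}. of_nat (a k) * ?g (a(k := a k - 1)))
      = (\<Sum>k\<in>I-{r}-{i}. of_nat (a k) * (u * v * (v + c + u) / ((v + c) * (1 + v + c) * c)))"
    unfolding g using fin pos
    by (intro sum.cong refl) (auto simp add: wt_lower_in u_def v_def c_def simp del: One_nat_def)
  also have "\<dots> = c * (u * v * (v + c + u) / ((v + c) * (1 + v + c) * c))"
    by (simp only: c_def wt_def sum_distrib_right)
  finally have 1: "(\<Sum>k\<in>I-{r}-{i}. of_nat (a k) * ?g (a(k := a k - 1))) = c * (u * v * (v + c + u) / ((v + c) * (1 + v + c) * c))" .
  have 2: "?g (a(r := a r - 1)) = (u - 1) * v * (v + c + u) / ((1 + v + c) * (2 + v + c) * (1 + c))"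
    unfolding g using pos[OF r] i by (simp add: wt_lower_out of_nat_diff u_def v_def c_def)
  have 3: "?g (a(i := a i - 1)) = u * (v - 1) * (v + c + u) / ((v + c) * (1 + v + c) * (1 + c))"
    unfolding g using pos[OF i(1)] i by (simp add: wt_lower_out of_nat_diff u_def v_def c_def)
  have 4: "?g a = u * v * (1 + v + c + u) / ((1 + v + c) * (2 + v + c) * (1 + c))"
    unfolding g by (simp add: u_def v_def c_def)
  \<comment> \<open>After the common factor \<open>X\<close> is taken out, the second and third group add up to \<open>1 / (1 + c)\<close>.\<close>
  define q X where "q = v + c" and "X = u * v * (q + u) / (1 + q)"
  have nz: "1 + q \<noteq> 0" "2 + q \<noteq> 0" "1 + c \<noteq> 0" "q \<noteq> 0" "c \<noteq> 0"
    using pv pc by (simp_all add: q_def)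
  have "(v - 1) / (q * (1 + c)) + 1 / q = 1 / (1 + c)"
    using nz by (simp add: divide_simps) (simp add: q_def)
  then have "(u - 1) / ((2 + q) * (1 + c)) + ((v - 1) / (q * (1 + c)) + 1 / q) = (1 + q + u) / ((2 + q) * (1 + c))"
    using nz by (simp add: divide_simps)
  then have "X * ((u - 1) / ((2 + q) * (1 + c))) + (X * ((v - 1) / (q * (1 + c))) + X * (1 / q))
      = X * ((1 + q + u) / ((2 + q) * (1 + c)))"
    by (simp only: flip: distrib_left)
  then have "u * ((u - 1) * v * (v + c + u) / ((1 + v + c) * (2 + v + c) * (1 + c)))
      + (v * (u * (v - 1) * (v + c + u) / ((v + c) * (1 + v + c) * (1 + c)))
      + c * (u * v * (v + c + u) / ((v + c) * (1 + v + c) * c)))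
      = (u + (v + c)) * (u * v * (1 + v + c + u) / ((1 + v + c) * (2 + v + c) * (1 + c)))"
    using nz(5) by (simp add: X_def q_def ac_simps)
  then show ?thesis
    unfolding harmonic_def sum.remove[OF fin r] sum.remove[OF fr ir] 1 2 3 4
    unfolding wt_remove[OF fin r] wt_remove[OF fr ir]
    by (simp only: u_def v_def c_def)
qed

section \<open>The constant term with a simple ratio\<close>

text \<open>
  If \<open>a s = 0\<close>, deleting \<open>s\<close> gives minus the sum of \<open>a i\<close> times the constant term for
  \<open>x\<^sub>i / x\<^sub>r\<close>. The index \<open>i = r\<close> contributes Dyson's constant term and the others the
  induction hypothesis; with \<open>b = wt (I-{r}) a\<close> the total is
  \<open>- a r * (1 - b / (1 + b)) = - a r / (1 + b)\<close>.
\<close>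

theorem CT_dyson_ratio:
  assumes "finite I" "r \<in> I" "s \<in> I" "s \<noteq> r"
  shows "CT (xpow s 1 * xpow r (-1) * dyson I a) = - (of_nat (a r) / (1 + wt (I-{r}) a)) * multinomial I a"
proof -
  have "r \<in> I \<longrightarrow> (\<forall>s\<in>I-{r}. CT (xpow s 1 * xpow r (-1) * dyson I a) = - (of_nat (a r) / (1 + wt (I-{r}) a)) * multinomial I a)"
    using assms(1)
  proof (induction I a rule: dyson_induct)
    case (step I a)
    note fin = step(1) and IHs = step(2,3)
    show ?case
    proof (intro impI ballI)
      fix s assume r: "r \<in> I" and s: "s \<in> I - {r}"
      have finr: "finite (I - {r})" using fin by simp
      have IH: "CT (xpow i 1 * xpow r (-1) * dyson (I-{k}) a) = - (of_nat (a r) / (1 + wt (I-{r}) a)) * multinomial I a"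
        if "k \<in> I" "k \<noteq> r" "a k = 0" "i \<in> I - {k} - {r}" for k i
      proof -
        have "wt (I-{k}-{r}) a = wt (I-{r}) a"
          using wt_remove[OF finr, of k a] that by (simp add: Diff_insert2[symmetric] insert_commute)
        then show ?thesis
          using IHs(1)[OF that(1)] that r multinomial_remove[where a = a, OF fin that(1,3)] by auto
      qed
      consider "a r = 0" | "a s = 0" | k where "k \<in> I" "k \<noteq> r" "k \<noteq> s" "a k = 0" | "\<And>k. k \<in> I \<Longrightarrow> a k > 0"
        by (metis gr0I)
      then show "CT (xpow s 1 * xpow r (-1) * dyson I a) = - (of_nat (a r) / (1 + wt (I-{r}) a)) * multinomial I a"
      proof cases
        case 1
        have "exps_in r {-1} (xpow s 1 * xpow r (-1))"
          using s by (intro exps_in_mult[where S="{0}" and T="{-1}"] exps_in_xpow) auto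
        then have "CT (xpow s 1 * xpow r (-1) * dyson I a) = 0"
          by (rule CT_times_dyson_vanishing[where e="-1" and a = a, OF fin r 1]) simp
        then show ?thesis using 1 by simp
      next
        case 2
        let ?b = "wt (I-{r}) a"
        have sI: "s \<in> I" "s \<noteq> r" using s by auto
        have b: "wt (I-{s}-{r}) a = ?b"
          using wt_remove[OF finr, of s a] s 2 by (simp add: Diff_insert2[symmetric] insert_commute)
        have rs: "r \<in> I - {s}" "finite (I - {s})" using r s fin by auto
        have g: "exps_in s {0} (xpow r (-1))" using sI by (intro exps_in_xpow) auto
        have "CT (xpow s 1 * xpow r (-1) * dyson I a) =
           - (\<Sum>i\<in>I-{s}. of_nat (a i) * CT (xpow i 1 * xpow r (-1) * dyson (I-{s}) a))"
          by (rule CT_dyson_remove_1[where a = a, OF fin sI(1) 2 g])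
        also have "\<dots> = - (of_nat (a r) * multinomial I a + (\<Sum>i\<in>I-{s}-{r}. of_nat (a i) * (- (of_nat (a r) / (1 + ?b)) * multinomial I a)))"
          using IH[OF sI 2] CT_dyson[OF rs(2), of a] multinomial_remove[where a = a, OF fin sI(1) 2]
          by (simp add: sum.remove[OF rs(2,1)])
        also have "\<dots> = - (of_nat (a r) * multinomial I a + ?b * (- (of_nat (a r) / (1 + ?b)) * multinomial I a))"
          by (simp only: b[symmetric]) (simp only: wt_def sum_distrib_right)
        also have "\<dots> = - (of_nat (a r) / (1 + ?b)) * multinomial I a"
          using wt_nonneg[of "I-{r}" a] by (simp add: divide_simps) algebra
        finally show ?thesis .
      next
        case (3 k)
        have "exps_in k {0} (xpow s 1 * xpow r (-1))"
          using 3 by (intro exps_in_mult[where S="{0}" and T="{0}"] exps_in_xpow) auto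
        then show ?thesis
          using CT_dyson_remove_0[where a = a, OF fin 3(1,4), of "xpow s 1 * xpow r (-1)"] IH[OF 3(1,2,4), of s] 3 s
          by simp
      next
        case 4
        have "0 < wt (I-{r}) a"
          using wt_le[OF finr s, of a] 4[of s] s by simp
        then have harm: "harmonic I a (\<lambda>a. - (of_nat (a r) / (1 + wt (I-{r}) a)))"
          by (intro harmonic_uminus harmonic_ratio fin r 4)
        show ?thesis
          by (rule CT_recurrence_step[OF fin _ 4 IHs(2)[OF _ 4, rule_format, OF _ _ r s] harm]) (use r in auto)
      qed
    qed
  qed
  then show ?thesis using assms by simp
qed

section \<open>Linear relations among the bracketed factors\<close>

definition ratio_term :: "nat set \<Rightarrow> (nat \<Rightarrow> nat) \<Rightarrow> nat \<Rightarrow> rat" where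
  "ratio_term J a i = of_nat (a i) / (1 + wt J a - of_nat (a i))"

text \<open>
  The bracketed factor of the formula for \<open>x\<^sub>s x\<^sub>t / x\<^sub>r\<^sup>2\<close>, with \<open>J\<close> the index set without
  \<open>r\<close> and \<open>u\<close> the exponent of \<open>x\<^sub>r\<close>. The case \<open>s = t\<close> has to be carried along, since deleting
  one variable turns \<open>x\<^sub>s x\<^sub>t\<close> into all \<open>x\<^sub>i x\<^sub>t\<close>, including \<open>x\<^sub>t\<^sup>2\<close>.
\<close>

definition bracket :: "nat set \<Rightarrow> (nat \<Rightarrow> nat) \<Rightarrow> rat \<Rightarrow> nat \<Rightarrow> nat \<Rightarrow> rat" where
  "bracket J a u s t = (if s = t then u - 1 else wt J a + 2 * u)
     - (1 + wt J a + u) * (\<Sum>i\<in>J-{s,t}. ratio_term J a i)"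

definition bracket_base :: "nat set \<Rightarrow> (nat \<Rightarrow> nat) \<Rightarrow> rat \<Rightarrow> rat" where
  "bracket_base J a u = u - 1 - (1 + wt J a + u) * (\<Sum>i\<in>J. ratio_term J a i)"

text \<open>
  Extending the sum from \<open>J - {s, t}\<close> to \<open>J\<close> leaves a part \<open>bracket_base\<close> independent of \<open>s\<close>
  and \<open>t\<close> and a correction that involves only their own ratio terms, so weighted sums over \<open>s\<close> and \<open>t\<close> can be
  evaluated in closed form.
\<close>

lemma bracket_eq:
  assumes "finite J" "s \<in> J" "t \<in> J"
  shows "bracket J a u s t = bracket_base J a u + (1 + wt J a + u) *
    (if s = t then ratio_term J a s else ratio_term J a s + ratio_term J a t + 1)"
proof (cases "s = t")
  case True
  then show ?thesis
    using assms by (simp add: bracket_def bracket_base_def sum.remove[of J t] algebra_simps)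
next
  case False
  have "sum f J = f s + f t + sum f (J-{s,t})" for f :: "nat \<Rightarrow> rat"
    using assms False by (simp add: sum.remove[of J s] sum.remove[of "J-{s}" t] Diff_insert2[symmetric] insert_commute)
  then show ?thesis
    using False by (simp add: bracket_def bracket_base_def algebra_simps)
qed

text \<open>
  Since \<open>h + 1 = (1 + b) / (1 + b - a i)\<close> for \<open>h = a i / (1 + b - a i)\<close>. This relation eliminates
  all products \<open>a i * h\<close> in the sums that follow.
\<close>

lemma ratio_term_mult:
  assumes "finite J" "i \<in> J"
  shows "of_nat (a i) * (ratio_term J a i + 1) = (1 + wt J a) * ratio_term J a i"
  using wt_le[OF assms, of a] by (simp add: ratio_term_def divide_simps)

lemma sum_weighted_ratio_terms:
  assumes J: "finite J"
  shows "(\<Sum>i\<in>J. of_nat (a i) * ratio_term J a i) = (1 + wt J a) * (\<Sum>i\<in>J. ratio_term J a i) - wt J a"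
proof -
  have "(\<Sum>i\<in>J. of_nat (a i) * ratio_term J a i) = (\<Sum>i\<in>J. (1 + wt J a) * ratio_term J a i - of_nat (a i))"
    using ratio_term_mult[OF J, of _ a] by (intro sum.cong refl) (simp add: algebra_simps)
  then show ?thesis
    by (simp only: sum_subtractf sum_distrib_left[symmetric] wt_def)
qed

lemma bracket_row:
  assumes J: "finite J" and t: "t \<in> J"
  shows "(\<Sum>i\<in>J. of_nat (a i) * bracket J a u i t) =
    (1 + wt J a) * (u - 1) - bracket_base J a u - (1 + wt J a + u) * ratio_term J a t"
proof -
  let ?h = "ratio_term J a" and ?b = "wt J a" and ?K = "bracket_base J a u"
  have "(\<Sum>i\<in>J. of_nat (a i) * bracket J a u i t) =
    (\<Sum>i\<in>J. of_nat (a i) * (?K + (1 + ?b + u) * (?h t + 1)) + (1 + ?b + u) * (of_nat (a i) * ?h i)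
       - (if i = t then (1 + ?b + u) * (of_nat (a t) * (?h t + 1)) else 0))"
    using J t by (intro sum.cong refl) (auto simp: bracket_eq algebra_simps)
  also have "\<dots> = ?b * (?K + (1 + ?b + u) * (?h t + 1)) + (1 + ?b + u) * ((1 + ?b) * (\<Sum>i\<in>J. ?h i) - ?b)
      - (1 + ?b + u) * ((1 + ?b) * ?h t)"
    unfolding sum_subtractf sum.distrib sum_distrib_left[symmetric] sum_distrib_right[symmetric]
      sum_weighted_ratio_terms[OF J] ratio_term_mult[OF J t]
    using J t by (simp add: wt_def)
  also have "\<dots> = (1 + ?b) * (u - 1) - ?K - (1 + ?b + u) * ?h t"
    unfolding bracket_base_def by algebra
  finally show ?thesis .
qed

lemma bracket_trace:
  assumes J: "finite J"
  shows "(\<Sum>i\<in>J. of_nat (a i) * bracket J a u i i) =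
    (1 + wt J a) * (u - 1) - bracket_base J a u - (1 + wt J a + u) * wt J a"
proof -
  let ?h = "ratio_term J a" and ?b = "wt J a" and ?K = "bracket_base J a u"
  have "(\<Sum>i\<in>J. of_nat (a i) * bracket J a u i i) =
    (\<Sum>i\<in>J. of_nat (a i) * ?K + (1 + ?b + u) * (of_nat (a i) * ?h i))"
    using J by (intro sum.cong refl) (auto simp: bracket_eq algebra_simps)
  also have "\<dots> = ?b * ?K + (1 + ?b + u) * ((1 + ?b) * (\<Sum>i\<in>J. ?h i) - ?b)"
    unfolding sum.distrib sum_distrib_left[symmetric] sum_distrib_right[symmetric]
      sum_weighted_ratio_terms[OF J] by (simp add: wt_def)
  also have "\<dots> = (1 + ?b) * (u - 1) - ?K - (1 + ?b + u) * ?b"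
    unfolding bracket_base_def by algebra
  finally show ?thesis .
qed

lemma bracket_double_sum:
  assumes J: "finite J"
  shows "(\<Sum>i\<in>J. \<Sum>j\<in>J. of_nat (a i) * of_nat (a j) * bracket J a u i j) =
    wt J a * ((1 + wt J a) * (u - 1) - bracket_base J a u)
      - (1 + wt J a) * (u - 1 - bracket_base J a u) + (1 + wt J a + u) * wt J a"
proof -
  let ?h = "ratio_term J a" and ?b = "wt J a" and ?K = "bracket_base J a u"
  have "(\<Sum>i\<in>J. \<Sum>j\<in>J. of_nat (a i) * of_nat (a j) * bracket J a u i j) =
    (\<Sum>j\<in>J. of_nat (a j) * (\<Sum>i\<in>J. of_nat (a i) * bracket J a u i j))"
    by (subst sum.swap) (simp only: sum_distrib_left mult_ac)
  also have "\<dots> = (\<Sum>j\<in>J. of_nat (a j) * ((1 + ?b) * (u - 1) - ?K) - (1 + ?b + u) * (of_nat (a j) * ?h j))"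
    using J by (intro sum.cong refl) (simp add: bracket_row algebra_simps)
  also have "\<dots> = ?b * ((1 + ?b) * (u - 1) - ?K) - (1 + ?b + u) * ((1 + ?b) * (\<Sum>i\<in>J. ?h i) - ?b)"
    unfolding sum_subtractf sum_distrib_left[symmetric] sum_distrib_right[symmetric]
      sum_weighted_ratio_terms[OF J] by (simp add: wt_def)
  also have "\<dots> = ?b * ((1 + ?b) * (u - 1) - ?K) - (1 + ?b) * (u - 1 - ?K) + (1 + ?b + u) * ?b"
    unfolding bracket_base_def by algebra
  finally show ?thesis .
qed

lemma ratio_term_zero: "a k = 0 \<Longrightarrow> ratio_term J a k = 0"
  by (simp add: ratio_term_def)

lemma insert_zero_weight:
  assumes "finite J" "k \<notin> J" "a k = 0"
  shows "wt (insert k J) a = wt J a" "ratio_term (insert k J) a i = ratio_term J a i"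
    "bracket_base (insert k J) a u = bracket_base J a u"
  using assms by (simp_all add: bracket_base_def ratio_term_def)

lemma bracket_insert_zero:
  assumes "finite J" "k \<notin> J" "a k = 0" "s \<in> J" "t \<in> J"
  shows "bracket (insert k J) a u s t = bracket J a u s t"
  using assms by (simp add: bracket_eq insert_zero_weight)

text \<open>
  Up to a common factor, this is the relation that deletion of an index \<open>k\<close> of exponent 0
  imposes on the constant term with \<open>x\<^sub>k x\<^sub>t / x\<^sub>r\<^sup>2\<close>. The term \<open>u * (2 + wt J a)\<close> comes from
  \<open>x\<^sub>r x\<^sub>t / x\<^sub>r\<^sup>2 = x\<^sub>t / x\<^sub>r\<close>.
\<close>

lemma bracket_boundary_distinct:
  assumes J: "finite J" "k \<notin> J" "a k = 0" and t: "t \<in> J"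
  shows "bracket (insert k J) a u k t = u * (2 + wt J a) - (\<Sum>i\<in>J. of_nat (a i) * bracket J a u i t)"
proof -
  have "bracket (insert k J) a u k t = bracket_base J a u + (1 + wt J a + u) * (ratio_term J a t + 1)"
    using bracket_eq[of "insert k J" k t a u] J t by (auto simp: insert_zero_weight ratio_term_zero)
  then show ?thesis unfolding bracket_row[OF J(1) t] by algebra
qed

text \<open>
  The same for \<open>x\<^sub>k\<^sup>2 / x\<^sub>r\<^sup>2\<close>. The middle terms collect the contributions with one index equal to
  \<open>r\<close>, which come from \<open>x\<^sub>i / x\<^sub>r\<close>, and those with both equal to \<open>r\<close>, which come from Dyson's
  constant term.
\<close>

lemma bracket_boundary_double:
  assumes J: "finite J" "k \<notin> J" "a k = 0"
  shows "2 * bracket (insert k J) a u k k =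
    (\<Sum>i\<in>J. \<Sum>j\<in>J. of_nat (a i) * of_nat (a j) * bracket J a u i j)
    - 2 * u * wt J a * (2 + wt J a) + (u - 1) * (1 + wt J a) * (2 + wt J a)
    - (\<Sum>i\<in>J. of_nat (a i) * bracket J a u i i)"
proof -
  have "bracket (insert k J) a u k k = bracket_base J a u"
    using bracket_eq[of "insert k J" k k a u] J by (auto simp: insert_zero_weight ratio_term_zero)
  then show ?thesis unfolding bracket_double_sum[OF J(1)] bracket_trace[OF J(1)] by (simp add: algebra_simps)
qed

section \<open>The constant term with a squared denominator\<close>

text \<open>
  The formula is a combination of the three harmonic functions above: with \<open>u = a r\<close> and
  \<open>b = wt (I-{r}) a\<close>, one has \<open>b + 2 * u = 2 * (u - 1) + (b + 2)\<close>, and the summand \<open>b + 2\<close> cancels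
  a factor of the denominator.
\<close>

lemma harmonic_bracket:
  assumes fin: "finite I" and r: "r \<in> I" and s: "s \<in> I-{r}" and pos: "\<And>k. k \<in> I \<Longrightarrow> a k > 0"
  shows "harmonic I a (\<lambda>a. of_nat (a r) / ((1 + wt (I-{r}) a) * (2 + wt (I-{r}) a)) * bracket (I-{r}) a (of_nat (a r)) s t)"
proof -
  define g1 g2 g3 where
    "g1 = (\<lambda>a. rat_of_nat (a r) / (1 + wt (I-{r}) a))" and
    "g2 = (\<lambda>a. rat_of_nat (a r) * (of_nat (a r) - 1) / ((1 + wt (I-{r}) a) * (2 + wt (I-{r}) a)))" and
    "g3 = (\<lambda>i a. rat_of_nat (a r) * of_nat (a i) * (1 + wt (I-{r}) a + of_nat (a r)) /
      ((1 + wt (I-{r}) a) * (2 + wt (I-{r}) a) * (1 + wt (I-{r}) a - of_nat (a i))))"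
  have finr: "finite (I-{r})" using fin by simp
  have b: "wt (I-{r}) a > 0"
    using wt_le[OF finr s, of a] pos[of s] s by simp
  have h1: "harmonic I a g1" unfolding g1_def by (rule harmonic_ratio[OF fin r pos b])
  have h2: "harmonic I a g2" unfolding g2_def by (rule harmonic_falling_ratio[OF fin r pos b])
  \<comment> \<open>Since \<open>i\<close> differs from \<open>s\<close>, the weight outside \<open>r\<close> and \<open>i\<close> is at least \<open>a s > 0\<close>.\<close>
  have h3: "harmonic I a (g3 i)" if i: "i \<in> I-{r}-{s,t}" for i
  proof -
    have "0 < wt (I-{r}-{i}) a"
      using wt_le[of "I-{r}-{i}" s a] pos[of s] s i fin by auto
    then show ?thesis
      unfolding g3_def using i by (intro harmonic_cross_ratio[OF fin r _ _ pos]) auto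
  qed
  have third: "harmonic I a (\<lambda>a. \<Sum>i\<in>I-{r}-{s,t}. g3 i a)"
    by (rule harmonic_sum) (rule h3)
  have nz: "1 + wt (I-{r}) a \<noteq> 0" "2 + wt (I-{r}) a \<noteq> 0" for a
    using wt_nonneg[of "I-{r}" a] by simp_all
  have eq: "of_nat (a r) / ((1 + wt (I-{r}) a) * (2 + wt (I-{r}) a)) * bracket (I-{r}) a (of_nat (a r)) s t
      = (if s = t then g2 a else g2 a + g2 a + g1 a) - (\<Sum>i\<in>I-{r}-{s,t}. g3 i a)" for a
  proof -
    let ?u = "rat_of_nat (a r)" and ?b = "wt (I-{r}) a"
    have "?u / ((1 + ?b) * (2 + ?b)) * ((1 + ?b + ?u) * (\<Sum>i\<in>I-{r}-{s,t}. ratio_term (I-{r}) a i)) = (\<Sum>i\<in>I-{r}-{s,t}. g3 i a)"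
      unfolding sum_distrib_left g3_def ratio_term_def by (intro sum.cong refl) (simp add: mult_ac)
    moreover have "?u / ((1 + ?b) * (2 + ?b)) * (if s = t then ?u - 1 else ?b + 2 * ?u) = (if s = t then g2 a else g2 a + g2 a + g1 a)"
      unfolding g1_def g2_def using nz[of a] by (simp add: divide_simps) (simp add: algebra_simps)
    ultimately show ?thesis
      unfolding bracket_def right_diff_distrib by simp
  qed
  show ?thesis
    unfolding eq
  proof (cases "s = t")
    case True
    show "harmonic I a (\<lambda>a. (if s = t then g2 a else g2 a + g2 a + g1 a) - (\<Sum>i\<in>I-{r}-{s,t}. g3 i a))"
      unfolding if_P[OF True] by (rule harmonic_diff[OF h2 third])
  next
    case False
    show "harmonic I a (\<lambda>a. (if s = t then g2 a else g2 a + g2 a + g1 a) - (\<Sum>i\<in>I-{r}-{s,t}. g3 i a))"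
      unfolding if_not_P[OF False] by (rule harmonic_diff[OF harmonic_add[OF harmonic_add[OF h2 h2] h1] third])
  qed
qed

text \<open>
  The induction proves the formula for all \<open>s\<close> and \<open>t\<close> at once, equal or not. If all exponents
  are positive, Good's recursion applies. A zero exponent at \<open>r\<close> makes both sides vanish, an index
  outside \<open>{r, s, t}\<close> of exponent zero can be dropped on both sides, and a zero exponent at \<open>s\<close> or \<open>t\<close> is covered by the
  boundary relations for \<open>bracket\<close>.
\<close>

theorem CT_dyson_square_ratio:
  assumes "finite I" "r \<in> I" "s \<in> I-{r}" "t \<in> I-{r}"
  shows "CT (xpow s 1 * xpow t 1 * xpow r (-2) * dyson I a) =
    of_nat (a r) / ((1 + wt (I-{r}) a) * (2 + wt (I-{r}) a)) * bracket (I-{r}) a (of_nat (a r)) s t * multinomial I a"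
proof -
  define p where "p I a = rat_of_nat (a r) / ((1 + wt (I-{r}) a) * (2 + wt (I-{r}) a))" for I and a :: "nat \<Rightarrow> nat"
  have "r \<in> I \<longrightarrow> (\<forall>s\<in>I-{r}. \<forall>t\<in>I-{r}. CT (xpow s 1 * xpow t 1 * xpow r (-2) * dyson I a) =
      p I a * bracket (I-{r}) a (of_nat (a r)) s t * multinomial I a)"
    using assms(1)
  proof (induction I a rule: dyson_induct)
    case (step I a)
    note fin = step(1) and IHs = step(2,3)
    define F where "F s t \<longleftrightarrow> CT (xpow s 1 * xpow t 1 * xpow r (-2) * dyson I a) =
        p I a * bracket (I-{r}) a (of_nat (a r)) s t * multinomial I a" for s t
    show ?case
    proof (intro impI ballI)
      fix s t assume r: "r \<in> I" and s: "s \<in> I-{r}" and t: "t \<in> I-{r}"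
      have finr: "finite (I - {r})" using fin by simp
      have deg: "exps_in k {0} (xpow i e)" if "i \<noteq> k" for i k e
        using that by (intro exps_in_xpow) simp
      have F_sym: "F s t \<longleftrightarrow> F t s" for s t
        by (simp add: F_def bracket_def insert_commute mult_ac eq_commute[of s t])
      have Ir: "I-{r} = insert k (I-{k}-{r})" if "k \<in> I" "k \<noteq> r" for k
        using that by auto
      have wt_eq: "wt (I-{k}-{r}) a = wt (I-{r}) a" if "k \<in> I" "k \<noteq> r" "a k = 0" for k
        unfolding Ir[OF that(1,2)] by (rule insert_zero_weight(1)[symmetric]) (use fin that in auto)
      have IH: "CT (xpow i 1 * xpow j 1 * xpow r (-2) * dyson (I-{k}) a) =
          p I a * bracket (I-{k}-{r}) a (of_nat (a r)) i j * multinomial I a"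
        if "k \<in> I" "k \<noteq> r" "a k = 0" "i \<in> I-{k}-{r}" "j \<in> I-{k}-{r}" for k i j
        using IHs(1)[OF that(1)] that r multinomial_remove[where a = a, OF fin that(1,3)] wt_eq[OF that(1-3)]
        by (simp add: p_def)
      \<comment> \<open>Both auxiliary constant terms are written with the prefactor \<open>p\<close>, so that it factors out of the boundary sums.\<close>
      have IH_ratio: "CT (xpow i 1 * xpow r (-1) * dyson (I-{k}) a) = - p I a * (2 + wt (I-{r}) a) * multinomial I a"
        if "k \<in> I" "k \<noteq> r" "a k = 0" "i \<in> I-{k}-{r}" for k i
      proof -
        have "2 + wt (I-{r}) a \<noteq> 0" using wt_nonneg[of "I-{r}" a] by simp
        then show ?thesis
        using CT_dyson_ratio[of "I-{k}" r i a] fin that r multinomial_remove[where a = a, OF fin that(1,3)] wt_eq[OF that(1-3)]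
          by (simp add: p_def)
      qed
      have IH_zero: "of_nat (a r) * CT (dyson (I-{k}) a) = p I a * (1 + wt (I-{r}) a) * (2 + wt (I-{r}) a) * multinomial I a"
        if "k \<in> I" "a k = 0" for k
      proof -
        have "1 + wt (I-{r}) a \<noteq> 0" "2 + wt (I-{r}) a \<noteq> 0" using wt_nonneg[of "I-{r}" a] by simp_all
        then show ?thesis
          using CT_dyson[of "I-{k}" a] fin multinomial_remove[where a = a, OF fin that]
          by (simp add: p_def)
      qed
      have cancel: "xpow r 1 * xpow r (-2) = xpow r (-1)" "xpow r 1 * xpow r (-1) = 1"
        by (simp_all flip: xpow_add)
      have cancel': "xpow r 1 * xpow i 1 * xpow r (-2) = xpow i 1 * xpow r (-1)"
         "xpow i 1 * xpow r 1 * xpow r (-2) = xpow i 1 * xpow r (-1)"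
         "xpow r 1 * xpow r 1 * xpow r (-2) = 1" for i
        using cancel by (simp_all add: mult.assoc mult.left_commute)
      have simple: "F s t" if st: "s \<in> I-{r}" "t \<in> I-{r}" "s \<noteq> t" "a s = 0" for s t
      proof -
        define J where "J = I-{s}-{r}"
        have sI: "s \<in> I" "s \<noteq> r" using st by auto
        have J: "finite J" "s \<notin> J" "t \<in> J" using fin st by (auto simp: J_def)
        have rs: "finite (I-{s})" "r \<in> I-{s}" using fin r sI by auto
        have wJ: "wt (I-{r}) a = wt J a" using wt_eq[OF sI st(4)] by (simp add: J_def)
        have "CT (xpow s 1 * (xpow t 1 * xpow r (-2)) * dyson I a) =
            - (\<Sum>i\<in>I-{s}. of_nat (a i) * CT (xpow i 1 * (xpow t 1 * xpow r (-2)) * dyson (I-{s}) a))"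
          using st sI by (intro CT_dyson_remove_1[where a = a, OF fin sI(1) st(4)] exps_in_mult[where S="{0}" and T="{0}"] deg) auto
        also have "\<dots> = - (of_nat (a r) * CT (xpow t 1 * xpow r (-1) * dyson (I-{s}) a)
            + (\<Sum>i\<in>J. of_nat (a i) * CT (xpow i 1 * xpow t 1 * xpow r (-2) * dyson (I-{s}) a)))"
          by (simp only: sum.remove[OF rs] J_def[symmetric] mult.assoc[symmetric] cancel')
        also have "\<dots> = - (of_nat (a r) * (- p I a * (2 + wt J a) * multinomial I a)
            + (\<Sum>i\<in>J. of_nat (a i) * (p I a * bracket J a (of_nat (a r)) i t * multinomial I a)))"
          using IH[OF sI st(4)] IH_ratio[OF sI st(4)] J by (simp add: wJ J_def[symmetric])
        also have "\<dots> = p I a * (of_nat (a r) * (2 + wt J a) - (\<Sum>i\<in>J. of_nat (a i) * bracket J a (of_nat (a r)) i t)) * multinomial I a"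
          by (simp add: sum_distrib_left algebra_simps)
        also have "\<dots> = p I a * bracket (insert s J) a (of_nat (a r)) s t * multinomial I a"
          using bracket_boundary_distinct[where a = a, OF J(1,2) st(4) J(3)] by simp
        finally show ?thesis
          by (simp only: F_def mult.assoc Ir[OF sI] J_def)
      qed
      have double: "F s s" if s: "s \<in> I-{r}" "a s = 0" for s
      proof -
        define J where "J = I-{s}-{r}"
        define M where "M i j = CT (xpow i 1 * xpow j 1 * xpow r (-2) * dyson (I-{s}) a)" for i j
        let ?u = "rat_of_nat (a r)" and ?b = "wt J a" and ?p = "p I a" and ?c = "multinomial I a"
        let ?N = "bracket J a ?u"
        have sI: "s \<in> I" "s \<noteq> r" using s by auto
        have J: "finite J" "s \<notin> J" using fin by (auto simp: J_def)
        have rs: "finite (I-{s})" "r \<in> I-{s}" using fin r sI by auto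
        have wJ: "wt (I-{r}) a = ?b" using wt_eq[OF sI s(2)] by (simp add: J_def)
        have M: "M i j = ?p * ?N i j * ?c" if "i \<in> J" "j \<in> J" for i j
          using IH[OF sI s(2), of i j] that by (simp add: M_def J_def)
        have Mr: "M i r = - ?p * (2 + ?b) * ?c" "M r i = - ?p * (2 + ?b) * ?c" if "i \<in> J" for i
          using IH_ratio[OF sI s(2), of i] that by (simp_all add: M_def cancel' wJ J_def[symmetric])
        have Mrr: "?u * M r r = ?p * (1 + ?b) * (2 + ?b) * ?c"
          using IH_zero[OF sI(1) s(2)] by (simp add: M_def cancel' wJ)
        have "2 * CT (xpow s 1 * xpow s 1 * xpow r (-2) * dyson I a) =
            (\<Sum>i\<in>I-{s}. \<Sum>j\<in>I-{s}. of_nat (a i) * of_nat (a j) * M i j) - (\<Sum>i\<in>I-{s}. of_nat (a i) * M i i)"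
          unfolding M_def using sI by (intro CT_dyson_remove_2[where a = a, OF fin sI(1) s(2)] deg) auto
        also have "(\<Sum>i\<in>I-{s}. \<Sum>j\<in>I-{s}. of_nat (a i) * of_nat (a j) * M i j) =
            ?u * (?u * M r r) + (\<Sum>j\<in>J. ?u * of_nat (a j) * M r j)
            + ((\<Sum>i\<in>J. of_nat (a i) * ?u * M i r) + (\<Sum>i\<in>J. \<Sum>j\<in>J. of_nat (a i) * of_nat (a j) * M i j))"
          by (simp only: sum.remove[OF rs] J_def[symmetric] sum.distrib mult.assoc)
        also have "\<dots> = ?u * (?p * (1 + ?b) * (2 + ?b) * ?c) + ?u * ?b * (- ?p * (2 + ?b) * ?c)
            + (?b * ?u * (- ?p * (2 + ?b) * ?c) + ?p * ?c * (\<Sum>i\<in>J. \<Sum>j\<in>J. of_nat (a i) * of_nat (a j) * ?N i j))"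
        proof -
          have "(\<Sum>j\<in>J. ?u * of_nat (a j) * M r j) = ?u * ?b * (- ?p * (2 + ?b) * ?c)"
            unfolding wt_def[of J] sum_distrib_left sum_distrib_right
            by (intro sum.cong refl) (simp only: Mr wt_def sum_distrib_left sum_distrib_right)
          moreover have "(\<Sum>i\<in>J. of_nat (a i) * ?u * M i r) = ?b * ?u * (- ?p * (2 + ?b) * ?c)"
            unfolding wt_def[of J] sum_distrib_left sum_distrib_right
            by (intro sum.cong refl) (simp only: Mr wt_def sum_distrib_left sum_distrib_right)
          moreover have "(\<Sum>i\<in>J. \<Sum>j\<in>J. of_nat (a i) * of_nat (a j) * M i j) = ?p * ?c * (\<Sum>i\<in>J. \<Sum>j\<in>J. of_nat (a i) * of_nat (a j) * ?N i j)"
            unfolding sum_distrib_left by (intro sum.cong refl) (simp add: M)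
          ultimately show ?thesis by (simp only: Mrr)
        qed
        also have "(\<Sum>i\<in>I-{s}. of_nat (a i) * M i i) = ?p * (1 + ?b) * (2 + ?b) * ?c + ?p * ?c * (\<Sum>i\<in>J. of_nat (a i) * ?N i i)"
        proof -
          have "(\<Sum>i\<in>J. of_nat (a i) * M i i) = ?p * ?c * (\<Sum>i\<in>J. of_nat (a i) * ?N i i)"
            unfolding sum_distrib_left by (intro sum.cong refl) (simp add: M)
          then show ?thesis by (simp only: sum.remove[OF rs] J_def[symmetric] Mrr)
        qed
        finally have "2 * CT (xpow s 1 * xpow s 1 * xpow r (-2) * dyson I a) = ?p * ?c * (2 * bracket (insert s J) a ?u s s)"
          unfolding bracket_boundary_double[where a = a, OF J s(2)] by (simp add: algebra_simps)
        then show ?thesis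
          by (simp add: F_def Ir[OF sI] J_def)
      qed
      consider "a r = 0" | "a s = 0" | "a t = 0" | k where "k \<in> I" "k \<noteq> r" "k \<noteq> s" "k \<noteq> t" "a k = 0"
        | "\<And>k. k \<in> I \<Longrightarrow> a k > 0"
        by (metis gr0I)
      then have "F s t"
      proof cases
        case 1
        have "exps_in r {-2} (xpow s 1 * xpow t 1 * xpow r (-2))"
          using s t by (intro exps_in_mult[where S="{0}" and T="{-2}"] exps_in_mult[where S="{0}" and T="{0}"] exps_in_xpow) auto
        then have "CT (xpow s 1 * xpow t 1 * xpow r (-2) * dyson I a) = 0"
          by (rule CT_times_dyson_vanishing[where e="-2" and a = a, OF fin r 1]) simp
        then show ?thesis using 1 by (simp add: F_def p_def)
      next
        case 2
        then show ?thesis using simple[OF s t] double[OF s] by (cases "s = t") auto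
      next
        case 3
        then show ?thesis using simple[OF t s] double[OF t] F_sym by (cases "s = t") auto
      next
        case (4 k)
        have "exps_in k {0} (xpow s 1 * xpow t 1 * xpow r (-2))"
          using 4 by (intro exps_in_mult[where S="{0}" and T="{0}"] deg) auto
        then have "CT (xpow s 1 * xpow t 1 * xpow r (-2) * dyson I a) = CT (xpow s 1 * xpow t 1 * xpow r (-2) * dyson (I-{k}) a)"
          by (rule CT_dyson_remove_0[where a = a, OF fin 4(1,5)])
        also have "\<dots> = p I a * bracket (I-{k}-{r}) a (of_nat (a r)) s t * multinomial I a"
          using 4 s t by (intro IH) auto
        also have "bracket (I-{k}-{r}) a (of_nat (a r)) s t = bracket (I-{r}) a (of_nat (a r)) s t"
          unfolding Ir[OF 4(1,2)] using fin 4 s t by (intro bracket_insert_zero[symmetric]) auto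
        finally show ?thesis by (simp only: F_def)
      next
        case 5
        have harm: "harmonic I a (\<lambda>a. p I a * bracket (I-{r}) a (of_nat (a r)) s t)"
          unfolding p_def by (rule harmonic_bracket[OF fin r s 5])
        show ?thesis
          unfolding F_def
          by (rule CT_recurrence_step[OF fin _ 5 IHs(2)[OF _ 5, rule_format, OF _ _ r s t] harm]) (use r in auto)
      qed
      then show "CT (xpow s 1 * xpow t 1 * xpow r (-2) * dyson I a) =
        p I a * bracket (I-{r}) a (of_nat (a r)) s t * multinomial I a" by (simp only: F_def)
    qed
  qed
  then show ?thesis using assms by (simp add: p_def)
qed

theorem theorem1p3:
  fixes n r s t :: nat and a :: "nat \<Rightarrow> nat"
  assumes "r \<in> {1..n}" and "s \<in> {1..n}" and "t \<in> {1..n}"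
    and "r \<noteq> s" and "r \<noteq> t" and "s \<noteq> t"
  shows "CT (xpow s 1 * xpow t 1 * xpow r (-2) * dyson_product n a) =
    rat_of_nat (a r) /
      ((1 + rat_of_nat (weight_except n a r)) * (2 + rat_of_nat (weight_except n a r))) *
    ((rat_of_nat (weight n a) + rat_of_nat (a r)) -
      (\<Sum>i\<in>{1..n} - {r, s, t}.
        rat_of_nat (a i) * (1 + rat_of_nat (weight n a)) /
          (1 + rat_of_nat (weight_except n a r) - rat_of_nat (a i)))) *
    dyson_coeff n a"
proof -
  let ?J = "{1..n} - {r}"
  have "weight n a = a r + sum a ?J"
    using assms(1) by (simp add: weight_def sum.remove)
  then have w: "rat_of_nat (weight n a) = of_nat (a r) + wt ?J a"
    and b: "rat_of_nat (weight_except n a r) = wt ?J a"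
    by (simp_all add: weight_except_def wt_def)
  have c: "dyson_coeff n a = multinomial {1..n} a"
    by (simp add: dyson_coeff_def multinomial_def weight_def)
  have "CT (xpow s 1 * xpow t 1 * xpow r (-2) * dyson_product n a) =
      of_nat (a r) / ((1 + wt ?J a) * (2 + wt ?J a)) * bracket ?J a (of_nat (a r)) s t * multinomial {1..n} a"
    unfolding dyson_product_eq by (rule CT_dyson_square_ratio) (use assms in auto)
  moreover have "bracket ?J a (of_nat (a r)) s t = (rat_of_nat (weight n a) + rat_of_nat (a r)) -
      (\<Sum>i\<in>{1..n} - {r, s, t}. rat_of_nat (a i) * (1 + rat_of_nat (weight n a)) /
          (1 + rat_of_nat (weight_except n a r) - rat_of_nat (a i)))"
    unfolding bracket_def ratio_term_def w b sum_distrib_left using assms(6)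
    by (simp add: Diff_insert2[symmetric] mult_ac add_ac)
  ultimately show ?thesis by (simp only: b c)
qed

end
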